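(* For every permutation $\pi$ of length at least $2$ there exists a unique simple permutation $\sigma$ of length $k \ge 2$, and permutations $\alpha_1, \alpha_2, \ldots, \alpha_k$ (each of length at least $1$), such that $$\pi = \sigma[\alpha_1, \alpha_2, \ldots, \alpha_k].$$ Moreover, if $\sigma \neq 12, 21$ then $\alpha_1, \alpha_2, \ldots, \alpha_k$ are also uniquely determined. If $\sigma = 12$ (respectively $\sigma = 21$) then $\alpha_1$ and $\alpha_2$ are uniquely determined subject to the additional condition that $\alpha_1$ be plus indecomposable (respectively minus indecomposable).
   Context: A permutation of length $n \ge 1$ is a bijection of $\{1,\ldots,n\}$ written in one-line notation. A block of a permutation $\pi$ of length $n$ is a nonempty set of consecutive positions whose set of values under $\pi$ is a set of consecutive integers. Singletons and the whole set $\{1,\ldots,n\}$ are always blocks; $\pi$ is simple if these are its only blocks. (So $1$, $12$, $21$ are simple.) Inflation: for a permutation $\sigma$ of length $k$ and permutations $\alpha_1,\ldots,\alpha_k$ (all of length at least $1$), $\sigma[\alpha_1,\ldots,\alpha_k]$ denotes the permutation of length $|\alpha_1|+\cdots+|\alpha_k|$ whose positions are divided, from left to right, into consecutive segments of lengths $|\alpha_1|,\ldots,|\alpha_k|$, such that each segment is a block, the values in the $i$-th segment are in the same relative order as $\alpha_i$, and all values of the $i$-th segment are smaller than all values of the $j$-th segment if and only if $\sigma(i)<\sigma(j)$ (for $i\ne j$). For example $67183524 = (3142)[12,1,1,2413]$. A permutation is plus indecomposable if it cannot be written as $(12)[\alpha,\beta]$, and minus indecomposable if it cannot be written as $(21)[\alpha,\beta]$,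 with $\alpha,\beta$ permutations of length at least $1$. *)

theory Defs
  imports "HOL-Combinatorics.Multiset_Permutations"
begin

(* Permutations of {1..n}, n \<ge> 1, are lists in one-line notation.  Values are
   numbered from 1, but positions are list indices and are numbered from 0. *)

definition is_perm :: "nat list \<Rightarrow> bool" where
  "is_perm \<pi> \<longleftrightarrow> \<pi> \<noteq> [] \<and> \<pi> \<in> permutations_of_set {1..length \<pi>}"

definition is_block :: "nat list \<Rightarrow> nat set \<Rightarrow> bool" where
  "is_block \<pi> I \<longleftrightarrow>
     (\<exists>a b. a \<le> b \<and> b < length \<pi> \<and> I = {a..b}) \<and> (\<exists>c d. (\<lambda>p. \<pi> ! p) ` I = {c..d})"

definition is_simple :: "nat list \<Rightarrow> bool" where
  "is_simple \<pi> \<longleftrightarrow>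
     is_perm \<pi> \<and> (\<forall>I. is_block \<pi> I \<longrightarrow> (\<exists>p. I = {p}) \<or> I = {0..<length \<pi>})"


definition seg_start :: "nat list list \<Rightarrow> nat \<Rightarrow> nat" where
  "seg_start \<alpha>s i = (\<Sum>j<i. length (\<alpha>s ! j))"

definition segment :: "nat list list \<Rightarrow> nat \<Rightarrow> nat set" where
  "segment \<alpha>s i = {seg_start \<alpha>s i ..< seg_start \<alpha>s i + length (\<alpha>s ! i)}"

definition is_inflation :: "nat list \<Rightarrow> nat list list \<Rightarrow> nat list \<Rightarrow> bool" where
  "is_inflation \<sigma> \<alpha>s \<pi> \<longleftrightarrow>
     is_perm \<pi> \<and> length \<pi> = (\<Sum>j<length \<sigma>. length (\<alpha>s ! j)) \<and>
     (\<forall>i<length \<sigma>. is_block \<pi> (segment \<alpha>s i)) \<and>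
     (\<forall>i<length \<sigma>. \<forall>p<length (\<alpha>s ! i). \<forall>q<length (\<alpha>s ! i).
        \<pi> ! (seg_start \<alpha>s i + p) < \<pi> ! (seg_start \<alpha>s i + q) \<longleftrightarrow> \<alpha>s ! i ! p < \<alpha>s ! i ! q) \<and>
     (\<forall>i<length \<sigma>. \<forall>j<length \<sigma>. i \<noteq> j \<longrightarrow>
        ((\<forall>p\<in>segment \<alpha>s i. \<forall>q\<in>segment \<alpha>s j. \<pi> ! p < \<pi> ! q) \<longleftrightarrow> \<sigma> ! i < \<sigma> ! j))"

(* \<sigma>[\<alpha>\<^sub>1,\<dots>,\<alpha>\<^sub>k]; meaningful when \<sigma> and all \<alpha>\<^sub>i are permutations and k is the length of \<sigma>,
   in which case the described permutation exists and is unique (is_inflation_ex1 below). *)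
definition inflate :: "nat list \<Rightarrow> nat list list \<Rightarrow> nat list" where
  "inflate \<sigma> \<alpha>s = (THE \<pi>. is_inflation \<sigma> \<alpha>s \<pi>)"

definition is_decomposition :: "nat list \<Rightarrow> nat list \<Rightarrow> nat list list \<Rightarrow> bool" where
  "is_decomposition \<pi> \<sigma> \<alpha>s \<longleftrightarrow>
     length \<alpha>s = length \<sigma> \<and> (\<forall>\<alpha>\<in>set \<alpha>s. is_perm \<alpha>) \<and> \<pi> = inflate \<sigma> \<alpha>s"

definition plus_indecomposable :: "nat list \<Rightarrow> bool" where
  "plus_indecomposable \<pi> \<longleftrightarrow>
     \<not> (\<exists>\<alpha> \<beta>. is_perm \<alpha> \<and> is_perm \<beta> \<and> \<pi> = inflate [1, 2] [\<alpha>, \<beta>])"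

definition minus_indecomposable :: "nat list \<Rightarrow> bool" where
  "minus_indecomposable \<pi> \<longleftrightarrow>
     \<not> (\<exists>\<alpha> \<beta>. is_perm \<alpha> \<and> is_perm \<beta> \<and> \<pi> = inflate [2, 1] [\<alpha>, \<beta>])"


lemma is_perm_alt: "is_perm \<pi> \<longleftrightarrow> \<pi> \<noteq> [] \<and> set \<pi> = {1..length \<pi>} \<and> distinct \<pi>"
  by (auto simp: is_perm_def permutations_of_set_def)

lemma seg_start_mono: "i \<le> j \<Longrightarrow> seg_start \<alpha>s i \<le> seg_start \<alpha>s j"
  unfolding seg_start_def by (rule sum_mono2) auto

lemma seg_start_Suc: "seg_start \<alpha>s (Suc i) = seg_start \<alpha>s i + length (\<alpha>s ! i)"
  by (simp add: seg_start_def)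

lemma seg_cases:
  assumes "p < seg_start \<alpha>s k"
  obtains i q where "i < k" "q < length (\<alpha>s ! i)" "p = seg_start \<alpha>s i + q"
  using assms
proof (induction k arbitrary: thesis)
  case 0
  then show ?case by (simp add: seg_start_def)
next
  case (Suc k)
  show ?case
  proof (cases "p < seg_start \<alpha>s k")
    case True
    then show ?thesis using Suc.IH Suc.prems(1) less_SucI by metis
  next
    case False
    then show ?thesis
      using Suc.prems(1)[of k "p - seg_start \<alpha>s k"] Suc.prems(2) by (simp add: seg_start_Suc)
  qed
qed

lemma seg_bound:
  assumes "i < k" "q < length (\<alpha>s ! i)"
  shows "seg_start \<alpha>s i + q < seg_start \<alpha>s k"
  using seg_start_mono[of "Suc i" k \<alpha>s] assms by (simp add: seg_start_Suc)

lemma perm_nth_rank: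
  assumes "is_perm \<pi>" "p < length \<pi>"
  shows "\<pi> ! p = Suc (card {q. q < length \<pi> \<and> \<pi> ! q < \<pi> ! p})"
proof -
  have d: "distinct \<pi>" "set \<pi> = {1..length \<pi>}" using assms by (auto simp: is_perm_alt)
  have pv: "1 \<le> \<pi> ! p" "\<pi> ! p \<le> length \<pi>" using d(2) assms(2) nth_mem[of p \<pi>] by auto
  have "(!) \<pi> ` {q. q < length \<pi> \<and> \<pi> ! q < \<pi> ! p} = {v \<in> set \<pi>. v < \<pi> ! p}"
    by (auto simp: set_conv_nth)
  also have "\<dots> = {1..<\<pi> ! p}" using d pv by auto
  finally have "card ((!) \<pi> ` {q. q < length \<pi> \<and> \<pi> ! q < \<pi> ! p}) = \<pi> ! p - 1" by simp
  moreover have "inj_on ((!) \<pi>) {q. q < length \<pi> \<and> \<pi> ! q < \<pi> ! p}"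
    using d(1) by (auto simp: inj_on_def nth_eq_iff_index_eq)
  ultimately show ?thesis using pv by (simp add: card_image)
qed

lemma perm_eqI:
  assumes "is_perm \<pi>" "is_perm \<tau>" "length \<pi> = length \<tau>"
    and "\<And>p q. p < length \<pi> \<Longrightarrow> q < length \<pi> \<Longrightarrow> \<pi> ! p < \<pi> ! q \<longleftrightarrow> \<tau> ! p < \<tau> ! q"
  shows "\<pi> = \<tau>"
proof (rule nth_equalityI)
  fix p assume p: "p < length \<pi>"
  have "{q. q < length \<pi> \<and> \<pi> ! q < \<pi> ! p} = {q. q < length \<tau> \<and> \<tau> ! q < \<tau> ! p}"
    using assms(3,4) p by auto
  then show "\<pi> ! p = \<tau> ! p"
    using perm_nth_rank[OF assms(1) p] perm_nth_rank[OF assms(2), of p] p assms(3) by simp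
qed (rule assms(3))

lemma is_inflation_less_iff:
  assumes "is_perm \<sigma>" "is_inflation \<sigma> \<alpha>s \<pi>"
    and "i < length \<sigma>" "p < length (\<alpha>s ! i)" "j < length \<sigma>" "q < length (\<alpha>s ! j)"
  shows "\<pi> ! (seg_start \<alpha>s i + p) < \<pi> ! (seg_start \<alpha>s j + q) \<longleftrightarrow>
           (if i = j then \<alpha>s ! i ! p < \<alpha>s ! j ! q else \<sigma> ! i < \<sigma> ! j)"
proof (cases "i = j")
  case True
  then show ?thesis using assms by (auto simp: is_inflation_def)
next
  case False
  have m: "seg_start \<alpha>s i + p \<in> segment \<alpha>s i" "seg_start \<alpha>s j + q \<in> segment \<alpha>s j"
    using assms by (auto simp: segment_def)
  have "\<sigma> ! i \<noteq> \<sigma> ! j" using assms False by (auto simp: is_perm_alt nth_eq_iff_index_eq)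
  moreover have "\<sigma> ! i < \<sigma> ! j \<Longrightarrow> \<pi> ! (seg_start \<alpha>s i + p) < \<pi> ! (seg_start \<alpha>s j + q)"
    using assms m False unfolding is_inflation_def by blast
  moreover have "\<sigma> ! j < \<sigma> ! i \<Longrightarrow> \<pi> ! (seg_start \<alpha>s j + q) < \<pi> ! (seg_start \<alpha>s i + p)"
    using assms m False unfolding is_inflation_def by blast
  ultimately show ?thesis using False by (meson linorder_neqE_nat order_less_asym)
qed

lemma is_inflation_unique:
  assumes \<sigma>: "is_perm \<sigma>" and "is_inflation \<sigma> \<alpha>s \<pi>" "is_inflation \<sigma> \<alpha>s \<tau>"
  shows "\<pi> = \<tau>"
proof (rule perm_eqI)
  have len: "length \<pi> = seg_start \<alpha>s (length \<sigma>)" "length \<tau> = seg_start \<alpha>s (length \<sigma>)"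
    using assms by (auto simp: is_inflation_def seg_start_def)
  show "is_perm \<pi>" "is_perm \<tau>" using assms by (auto simp: is_inflation_def)
  show "length \<pi> = length \<tau>" using len by simp
  fix p q assume "p < length \<pi>" "q < length \<pi>"
  then obtain i p' j q' where "i < length \<sigma>" "p' < length (\<alpha>s ! i)" "p = seg_start \<alpha>s i + p'"
    "j < length \<sigma>" "q' < length (\<alpha>s ! j)" "q = seg_start \<alpha>s j + q'"
    unfolding len by (elim seg_cases)
  then show "\<pi> ! p < \<pi> ! q \<longleftrightarrow> \<tau> ! p < \<tau> ! q"
    using is_inflation_less_iff[OF \<sigma> assms(2)] is_inflation_less_iff[OF \<sigma> assms(3)] by simp
qed

definition val_offset :: "nat list \<Rightarrow> nat list list \<Rightarrow> nat \<Rightarrow> nat" where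
  "val_offset \<sigma> \<alpha>s i = (\<Sum>j | j < length \<sigma> \<and> \<sigma> ! j < \<sigma> ! i. length (\<alpha>s ! j))"

definition inflation_list :: "nat list \<Rightarrow> nat list list \<Rightarrow> nat list" where
  "inflation_list \<sigma> \<alpha>s =
     concat (map (\<lambda>i. map (\<lambda>v. val_offset \<sigma> \<alpha>s i + v) (\<alpha>s ! i)) [0..<length \<sigma>])"

lemma inflation_list_nth:
  assumes "i < length \<sigma>" "p < length (\<alpha>s ! i)"
  shows "inflation_list \<sigma> \<alpha>s ! (seg_start \<alpha>s i + p) = val_offset \<sigma> \<alpha>s i + \<alpha>s ! i ! p"
proof -
  let ?f = "\<lambda>i. map (\<lambda>v. val_offset \<sigma> \<alpha>s i + v) (\<alpha>s ! i)"
  have split: "[0..<length \<sigma>] = [0..<i] @ i # [Suc i..<length \<sigma>]"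
    using assms(1) upt_add_eq_append[of 0 i "length \<sigma> - i"] by (simp add: upt_conv_Cons)
  have "length (concat (map ?f [0..<i])) = seg_start \<alpha>s i"
    by (simp add: length_concat seg_start_def o_def interv_sum_list_conv_sum_set_nat atLeast0LessThan)
  then show ?thesis
    unfolding inflation_list_def split using assms(2) by (simp add: nth_append)
qed

lemma is_inflation_inflation_list:
  assumes \<sigma>: "is_perm \<sigma>" and len: "length \<alpha>s = length \<sigma>" and \<alpha>: "\<forall>\<alpha>\<in>set \<alpha>s. is_perm \<alpha>"
  shows "is_inflation \<sigma> \<alpha>s (inflation_list \<sigma> \<alpha>s)"
proof -
  define k where "k = length \<sigma>"
  define \<pi> where "\<pi> = inflation_list \<sigma> \<alpha>s"
  let ?o = "val_offset \<sigma> \<alpha>s" and ?s = "seg_start \<alpha>s" and ?l = "\<lambda>i. length (\<alpha>s ! i)"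
  have ap: "is_perm (\<alpha>s ! i)" if "i < k" for i using that \<alpha> len by (auto simp: k_def)
  have apos: "?l i > 0" if "i < k" for i using ap[OF that] by (simp add: is_perm_alt)
  have aset: "set (\<alpha>s ! i) = {1..?l i}" if "i < k" for i using ap[OF that] by (simp add: is_perm_alt)
  have arange: "1 \<le> \<alpha>s ! i ! p" "\<alpha>s ! i ! p \<le> ?l i" if "i < k" "p < ?l i" for i p
    using aset[OF that(1)] nth_mem[OF that(2)] by auto
  have sd: "\<sigma> ! i \<noteq> \<sigma> ! j" if "i < k" "j < k" "i \<noteq> j" for i j
    using \<sigma> that by (auto simp: is_perm_alt k_def nth_eq_iff_index_eq)
  have nth: "\<pi> ! (?s i + p) = ?o i + \<alpha>s ! i ! p" if "i < k" "p < ?l i" for i p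
    using that inflation_list_nth by (simp add: \<pi>_def k_def)
  have lenp: "length \<pi> = ?s k"
    by (simp add: \<pi>_def inflation_list_def length_concat seg_start_def k_def o_def
        interv_sum_list_conv_sum_set_nat atLeast0LessThan)
  have off_ins: "?o i + ?l i = (\<Sum>j\<in>insert i {j. j < k \<and> \<sigma> ! j < \<sigma> ! i}. ?l j)" for i
    by (simp add: val_offset_def k_def)
  have off: "?o i + ?l i \<le> ?o j" if "i < k" "\<sigma> ! i < \<sigma> ! j" for i j
    unfolding off_ins unfolding val_offset_def using that by (intro sum_mono2) (auto simp: k_def)
  have offn: "?o i + ?l i \<le> length \<pi>" if "i < k" for i
    unfolding off_ins lenp unfolding seg_start_def using that by (intro sum_mono2) auto
  have less: "\<pi> ! (?s i + p) < \<pi> ! (?s j + q)"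
    if "i < k" "j < k" "p < ?l i" "q < ?l j" "\<sigma> ! i < \<sigma> ! j" for i j p q
    using off[OF that(1,5)] arange(2)[OF that(1,3)] arange(1)[OF that(2,4)]
    unfolding nth[OF that(1,3)] nth[OF that(2,4)] by linarith
  have dist: "distinct \<pi>"
    unfolding distinct_conv_nth
  proof (intro allI impI)
    fix p q assume pq: "p < length \<pi>" "q < length \<pi>" "p \<noteq> q"
    then obtain i p' j q' where *: "i < k" "p' < ?l i" "p = ?s i + p'" "j < k" "q' < ?l j" "q = ?s j + q'"
      unfolding lenp by (elim seg_cases)
    show "\<pi> ! p \<noteq> \<pi> ! q"
    proof (cases "i = j")
      case True
      then show ?thesis using * nth pq(3) ap[of i] by (auto simp: is_perm_alt nth_eq_iff_index_eq)
    next
      case False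
      then consider "\<sigma> ! i < \<sigma> ! j" | "\<sigma> ! j < \<sigma> ! i" using sd * by (meson linorder_neqE_nat)
      then show ?thesis
        by cases (use less[of i j p' q'] less[of j i q' p'] * in auto)
    qed
  qed
  have sub: "set \<pi> \<subseteq> {1..length \<pi>}"
  proof
    fix v assume "v \<in> set \<pi>"
    then obtain p where "p < length \<pi>" "v = \<pi> ! p" by (auto simp: in_set_conv_nth)
    then obtain i q where "i < k" "q < ?l i" "v = ?o i + \<alpha>s ! i ! q"
      using nth unfolding lenp by (metis seg_cases)
    then show "v \<in> {1..length \<pi>}" using arange[of i q] offn[of i] by simp
  qed
  have "set \<pi> = {1..length \<pi>}"
    by (rule card_subset_eq[OF _ sub]) (simp_all add: distinct_card[OF dist])
  moreover have "k > 0" using \<sigma> by (simp add: k_def is_perm_alt)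
  then have "\<pi> \<noteq> []" using offn[of 0] apos[of 0] by auto
  ultimately have perm: "is_perm \<pi>" using dist by (simp add: is_perm_alt)
  have block: "is_block \<pi> (segment \<alpha>s i)" if i: "i < k" for i
  proof -
    have "(\<lambda>p. \<pi> ! p) ` segment \<alpha>s i = (\<lambda>p. \<pi> ! (?s i + p)) ` {0..<?l i}"
      unfolding segment_def image_image[of "\<lambda>p. \<pi> ! p" "\<lambda>p. ?s i + p", symmetric] by (simp add: add.commute)
    also have "\<dots> = (\<lambda>p. ?o i + \<alpha>s ! i ! p) ` {0..<?l i}"
      using nth[OF i] by (intro image_cong) auto
    also have "\<dots> = (\<lambda>v. ?o i + v) ` ((!) (\<alpha>s ! i) ` {0..<?l i})" by (simp add: image_image)
    also have "(!) (\<alpha>s ! i) ` {0..<?l i} = {1..?l i}"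
      using aset[OF i] by (simp add: nth_image)
    finally have "(\<lambda>p. \<pi> ! p) ` segment \<alpha>s i = {?o i + 1..?o i + ?l i}" by simp
    moreover have "segment \<alpha>s i = {?s i..?s i + ?l i - 1}"
      unfolding segment_def set_eq_iff atLeastLessThan_iff atLeastAtMost_iff using apos[OF i] by arith
    moreover have "?s i + ?l i - 1 < length \<pi>"
      using seg_bound[of i k "?l i - 1" \<alpha>s] i apos[OF i] by (simp add: lenp)
    moreover have "?s i \<le> ?s i + ?l i - 1" using apos[OF i] by arith
    ultimately show ?thesis unfolding is_block_def by blast
  qed
  have order: "(\<forall>p\<in>segment \<alpha>s i. \<forall>q\<in>segment \<alpha>s j. \<pi> ! p < \<pi> ! q) \<longleftrightarrow> \<sigma> ! i < \<sigma> ! j"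
    if ij: "i < k" "j < k" "i \<noteq> j" for i j
  proof
    assume a: "\<forall>p\<in>segment \<alpha>s i. \<forall>q\<in>segment \<alpha>s j. \<pi> ! p < \<pi> ! q"
    have "?s i \<in> segment \<alpha>s i" "?s j \<in> segment \<alpha>s j" using apos ij by (auto simp: segment_def)
    then have "\<pi> ! (?s i) < \<pi> ! (?s j)" using a by blast
    then have "\<not> \<sigma> ! j < \<sigma> ! i" using less[of j i 0 0] ij apos by auto
    then show "\<sigma> ! i < \<sigma> ! j" using sd[OF ij] by simp
  next
    assume a: "\<sigma> ! i < \<sigma> ! j"
    show "\<forall>p\<in>segment \<alpha>s i. \<forall>q\<in>segment \<alpha>s j. \<pi> ! p < \<pi> ! q"
    proof (intro ballI)
      fix p q assume "p \<in> segment \<alpha>s i" "q \<in> segment \<alpha>s j"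
      then have "p - ?s i < ?l i" "q - ?s j < ?l j" "p = ?s i + (p - ?s i)" "q = ?s j + (q - ?s j)"
        by (auto simp: segment_def)
      then show "\<pi> ! p < \<pi> ! q" using less[of i j "p - ?s i" "q - ?s j"] ij a by simp
    qed
  qed
  show ?thesis
    unfolding is_inflation_def \<pi>_def[symmetric] k_def[symmetric]
    using perm lenp block order nth by (auto simp: seg_start_def)
qed

theorem is_inflation_ex1:
  assumes "is_perm \<sigma>" "length \<alpha>s = length \<sigma>" "\<forall>\<alpha>\<in>set \<alpha>s. is_perm \<alpha>"
  shows "\<exists>!\<pi>. is_inflation \<sigma> \<alpha>s \<pi>"
  using is_inflation_inflation_list[OF assms] is_inflation_unique[OF assms(1)] by blast

theorem inflate_eq_inflation_list:
  assumes "is_perm \<sigma>" "length \<alpha>s = length \<sigma>" "\<forall>\<alpha>\<in>set \<alpha>s. is_perm \<alpha>"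
  shows "inflate \<sigma> \<alpha>s = inflation_list \<sigma> \<alpha>s"
  unfolding inflate_def
  by (rule the1_equality[OF is_inflation_ex1[OF assms] is_inflation_inflation_list[OF assms]])

lemma "inflate [3, 1, 4, 2] [[1, 2], [1], [1], [2, 4, 1, 3]] = [6, 7, 1, 8, 3, 5, 2, 4]"
proof -
  have "val_offset \<sigma> \<alpha>s i = (\<Sum>j<length \<sigma>. if \<sigma> ! j < \<sigma> ! i then length (\<alpha>s ! j) else 0)" for \<sigma> \<alpha>s i
    unfolding val_offset_def by (subst sum.inter_filter[symmetric]) auto
  then show ?thesis
    by (subst inflate_eq_inflation_list)
      (auto simp: is_perm_alt inflation_list_def upt_rec lessThan_Suc numeral_eq_Suc)
qed

end

theory Submission
  imports Defs
begin

text \<open>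
  A set of consecutive positions is a block exactly when no outside value separates the values
  inside it, i.e. when it is a module of the linear order of values (\<open>order_module_imp_is_block\<close> and
  its converse). All arguments about blocks are made in this form. A decomposition of
  \<open>\<pi>\<close> amounts to a way of cutting the positions into consecutive blocks: the cuts determine both the
  quotient \<open>\<sigma>\<close> and the parts \<open>\<alpha>\<^sub>i\<close> (\<open>decomposition_determined_by_starts\<close>), and every such cutting
  arises (\<open>decomposition_from_module_cuts\<close>).

  Existence. Cutting \<open>\<pi>\<close> into single positions gives a quotient of length at least 2. Take a
  decomposition whose quotient is as short as possible, but of length at least 2. A nontrivial block
  of the quotient could be merged into a single segment (\<open>merge_block\<close>), giving a shorter one;
  so the quotient is simple.

  Uniqueness for a simple quotient \<open>\<sigma>\<close> of length greater than 2. Every proper block \<open>B\<close> of \<open>\<pi>\<close> lies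
  inside one segment (\<open>proper_block_in_segment\<close>). For the indices of the segments that meet \<open>B\<close> form
  a block of \<open>\<sigma>\<close>; if it is not a singleton, then \<open>B\<close> meets all segments. As \<open>B\<close> is proper, it misses
  the first or the last position, and then all indices but the first, or all but the last, form a
  block of \<open>\<sigma>\<close> as well, which is impossible for a simple permutation of length greater than 2. Hence
  the segments are the maximal proper blocks of \<open>\<pi>\<close>, which depend on \<open>\<pi>\<close> only; moreover no
  decomposition into fewer than \<open>length \<sigma>\<close>, but at least two, segments exists, which excludes
  the quotients \<open>12\<close> and \<open>21\<close>.

  Uniqueness for \<open>12\<close> and \<open>21\<close>. Comparing the first and the last value of \<open>\<pi>\<close> tells the two apart.
  For a fixed one of them, the decompositions correspond to the positions at which \<open>\<pi>\<close> splits, and the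
  first part is indecomposable exactly when it ends at the least of these positions
  (\<open>two_part_decomposition_unique\<close>).
\<close>

section \<open>Blocks as order modules\<close>

text \<open>
  Only \<open>\<pi> ! x < \<pi> ! p\<close> is compared: distinct entries make the statement about \<open>\<pi> ! p < \<pi> ! x\<close>
  equivalent.
\<close>

definition order_module :: "nat list \<Rightarrow> nat set \<Rightarrow> bool" where
  "order_module \<pi> B \<longleftrightarrow>
     (\<forall>p\<in>B. \<forall>q\<in>B. \<forall>x<length \<pi>. x \<notin> B \<longrightarrow> (\<pi> ! x < \<pi> ! p \<longleftrightarrow> \<pi> ! x < \<pi> ! q))"

lemma is_perm_nth_eq_iff:
  assumes "is_perm \<pi>" "p < length \<pi>" "q < length \<pi>"
  shows "\<pi> ! p = \<pi> ! q \<longleftrightarrow> p = q"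
  using assms by (simp add: is_perm_alt nth_eq_iff_index_eq)

lemma is_block_imp_order_module:
  assumes \<pi>: "is_perm \<pi>" and B: "is_block \<pi> B"
  shows "order_module \<pi> B"
proof -
  obtain a b c d where b: "b < length \<pi>" "B = {a..b}" and cd: "(\<lambda>p. \<pi> ! p) ` B = {c..d}"
    using B by (auto simp: is_block_def)
  have in_cd: "\<pi> ! p \<in> {c..d}" if "p \<in> B" for p using cd that by blast
  have out_cd: "\<pi> ! x \<notin> {c..d}" if "x < length \<pi>" "x \<notin> B" for x
  proof
    assume "\<pi> ! x \<in> {c..d}"
    then obtain p where "p \<in> B" "\<pi> ! x = \<pi> ! p" using cd by (metis imageE)
    then show False using is_perm_nth_eq_iff[OF \<pi>, of x p] that b by auto
  qed
  show ?thesis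
    unfolding order_module_def
  proof (intro ballI allI impI)
    fix p q x assume "p \<in> B" "q \<in> B" "x < length \<pi>" "x \<notin> B"
    then have "\<pi> ! p \<in> {c..d}" "\<pi> ! q \<in> {c..d}" "\<pi> ! x \<notin> {c..d}" using in_cd out_cd by blast+
    then show "\<pi> ! x < \<pi> ! p \<longleftrightarrow> \<pi> ! x < \<pi> ! q" unfolding atLeastAtMost_iff by linarith
  qed
qed

text \<open>
  A value strictly between the least and the greatest value on the interval would, if it occurred at a
  position outside, separate those two; and in a permutation every such value does occur.
\<close>

lemma order_module_imp_is_block:
  assumes \<pi>: "is_perm \<pi>" and ab: "a \<le> b" "b < length \<pi>" and M: "order_module \<pi> {a..b}"
  shows "is_block \<pi> {a..b}"
proof -
  let ?V = "(\<lambda>p. \<pi> ! p) ` {a..b}"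
  have V: "finite ?V" "?V \<noteq> {}" using ab by auto
  obtain p where p: "p \<in> {a..b}" "\<pi> ! p = Min ?V" using Min_in[OF V] by auto
  obtain q where q: "q \<in> {a..b}" "\<pi> ! q = Max ?V" using Max_in[OF V] by auto
  have range: "set \<pi> = {1..length \<pi>}" using \<pi> by (simp add: is_perm_alt)
  have "v \<in> ?V" if v: "Min ?V \<le> v" "v \<le> Max ?V" for v
  proof -
    have "\<pi> ! p \<in> set \<pi>" "\<pi> ! q \<in> set \<pi>" using p(1) q(1) ab(2) by simp_all
    then have "1 \<le> \<pi> ! p" "\<pi> ! q \<le> length \<pi>" unfolding range by simp_all
    then have "1 \<le> v" "v \<le> length \<pi>" using v p(2) q(2) by linarith+
    then have "v \<in> set \<pi>" unfolding range by simp
    then obtain x where x: "x < length \<pi>" "\<pi> ! x = v" by (auto simp: in_set_conv_nth)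
    show ?thesis
    proof (cases "x \<in> {a..b}")
      case True
      then show ?thesis using x by blast
    next
      case False
      then have "\<pi> ! x < \<pi> ! p \<longleftrightarrow> \<pi> ! x < \<pi> ! q"
        using M p(1) q(1) x(1) unfolding order_module_def by blast
      then have "v = \<pi> ! q" using v p(2) q(2) x(2) by linarith
      then show ?thesis using q by blast
    qed
  qed
  moreover have "Min ?V \<le> v \<and> v \<le> Max ?V" if "v \<in> ?V" for v using V(1) that by simp
  ultimately have "?V = {Min ?V..Max ?V}" unfolding set_eq_iff atLeastAtMost_iff by blast
  then show ?thesis using ab unfolding is_block_def by blast
qed

lemma is_simple_order_module:
  assumes "is_simple \<sigma>" "a \<le> b" "b < length \<sigma>" "order_module \<sigma> {a..b}"
  shows "a = b \<or> (a = 0 \<and> b = length \<sigma> - 1)"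
proof -
  have "is_block \<sigma> {a..b}" using assms by (auto simp: is_simple_def intro: order_module_imp_is_block)
  then consider p where "{a..b} = {p}" | "{a..b} = {0..<length \<sigma>}"
    using assms(1) unfolding is_simple_def by blast
  then show ?thesis
  proof cases
    case 1
    then show ?thesis using assms(2) by (metis atLeastAtMost_singleton_iff)
  next
    case 2
    have "a \<in> {a..b}" "b \<in> {a..b}" using assms(2) by auto
    moreover have "0 \<in> {0..<length \<sigma>}" "length \<sigma> - 1 \<in> {0..<length \<sigma>}" using assms(3) by auto
    ultimately have "a \<le> 0" "length \<sigma> - 1 \<le> b" unfolding 2[symmetric] by auto
    then show ?thesis using assms(3) by auto
  qed
qed

section \<open>Standardization\<close>

text \<open>
  For a list of distinct entries, the permutation in the same relative order; it provides both the
  parts and the quotient of a decomposition.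
\<close>

definition standardize :: "nat list \<Rightarrow> nat list" where
  "standardize xs = map (\<lambda>x. card {y \<in> set xs. y \<le> x}) xs"

lemma length_standardize [simp]: "length (standardize xs) = length xs"
  by (simp add: standardize_def)

lemma standardize_less_iff:
  assumes "i < length xs" "j < length xs"
  shows "standardize xs ! i < standardize xs ! j \<longleftrightarrow> xs ! i < xs ! j"
proof -
  have le: "card {y \<in> set xs. y \<le> x} \<le> card {y \<in> set xs. y \<le> x'}" if "x \<le> x'" for x x' :: nat
    using that by (intro card_mono) auto
  have less: "card {y \<in> set xs. y \<le> x} < card {y \<in> set xs. y \<le> x'}"
    if "x < x'" "x' \<in> set xs" for x x' :: nat
  proof (rule psubset_card_mono)
    have "{y \<in> set xs. y \<le> x} \<subseteq> {y \<in> set xs. y \<le> x'}" using that(1) by auto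
    moreover have "x' \<in> {y \<in> set xs. y \<le> x'} - {y \<in> set xs. y \<le> x}" using that by simp
    ultimately show "{y \<in> set xs. y \<le> x} \<subset> {y \<in> set xs. y \<le> x'}" by blast
  qed simp
  show ?thesis
    using assms le[of "xs ! j" "xs ! i"] less[of "xs ! i" "xs ! j"]
    by (auto simp: standardize_def not_less[symmetric])
qed

lemma is_perm_standardize:
  assumes "distinct xs" "xs \<noteq> []"
  shows "is_perm (standardize xs)"
proof -
  have dist: "distinct (standardize xs)"
    unfolding distinct_conv_nth
  proof (intro allI impI)
    fix i j assume ij: "i < length (standardize xs)" "j < length (standardize xs)" "i \<noteq> j"
    then have "xs ! i \<noteq> xs ! j" using assms(1) by (simp add: nth_eq_iff_index_eq)
    then show "standardize xs ! i \<noteq> standardize xs ! j"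
      using standardize_less_iff[of i xs j] standardize_less_iff[of j xs i] ij
      by (metis length_standardize less_irrefl linorder_neqE_nat)
  qed
  have "set (standardize xs) \<subseteq> {1..length xs}"
  proof
    fix v assume "v \<in> set (standardize xs)"
    then obtain x where x: "x \<in> set xs" "v = card {y \<in> set xs. y \<le> x}"
      by (auto simp: standardize_def)
    have "v \<le> card (set xs)" unfolding x(2) by (intro card_mono) auto
    moreover have "v > 0" unfolding x(2) using x(1) by (auto simp: card_gt_0_iff)
    ultimately show "v \<in> {1..length xs}" using card_length[of xs] by auto
  qed
  then have "set (standardize xs) = {1..length xs}"
    by (rule card_subset_eq[rotated]) (simp_all add: distinct_card[OF dist])
  then show ?thesis using dist assms(2) by (auto simp: is_perm_alt standardize_def)
qed

section \<open>Decompositions and their segments\<close>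

lemma decomposition_is_inflation:
  assumes "is_perm \<sigma>" "is_decomposition \<pi> \<sigma> \<alpha>s"
  shows "is_inflation \<sigma> \<alpha>s \<pi>"
  using assms is_inflation_inflation_list inflate_eq_inflation_list
  by (auto simp: is_decomposition_def)

lemma decompositionD:
  assumes "is_perm \<sigma>" "is_decomposition \<pi> \<sigma> \<alpha>s"
  shows "is_perm \<pi>" "length \<alpha>s = length \<sigma>" "length \<pi> = seg_start \<alpha>s (length \<sigma>)"
    and "\<And>i. i < length \<sigma> \<Longrightarrow> is_perm (\<alpha>s ! i)"
    and "\<And>i. i < length \<sigma> \<Longrightarrow> 0 < length (\<alpha>s ! i)"
    and "\<And>i. i < length \<sigma> \<Longrightarrow> is_block \<pi> (segment \<alpha>s i)"
proof -
  have inf: "is_inflation \<sigma> \<alpha>s \<pi>" using assms by (rule decomposition_is_inflation)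
  then show "is_perm \<pi>" "length \<pi> = seg_start \<alpha>s (length \<sigma>)"
    "\<And>i. i < length \<sigma> \<Longrightarrow> is_block \<pi> (segment \<alpha>s i)"
    by (auto simp: is_inflation_def seg_start_def)
  show "length \<alpha>s = length \<sigma>" using assms(2) by (simp add: is_decomposition_def)
  then show *: "\<And>i. i < length \<sigma> \<Longrightarrow> is_perm (\<alpha>s ! i)"
    using assms(2) by (simp add: is_decomposition_def)
  show "0 < length (\<alpha>s ! i)" if "i < length \<sigma>" for i using *[OF that] by (simp add: is_perm_alt)
qed

lemma decomposition_less_iff:
  assumes "is_perm \<sigma>" "is_decomposition \<pi> \<sigma> \<alpha>s" "i < length \<sigma>" "j < length \<sigma>" "i \<noteq> j"
    and "p \<in> segment \<alpha>s i" "q \<in> segment \<alpha>s j"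
  shows "\<pi> ! p < \<pi> ! q \<longleftrightarrow> \<sigma> ! i < \<sigma> ! j"
proof -
  obtain p' q' where "p' < length (\<alpha>s ! i)" "p = seg_start \<alpha>s i + p'"
    "q' < length (\<alpha>s ! j)" "q = seg_start \<alpha>s j + q'"
    using assms(6,7) by (auto simp: segment_def nat_le_iff_add)
  then show ?thesis
    using is_inflation_less_iff[OF assms(1) decomposition_is_inflation[OF assms(1,2)]] assms by simp
qed

lemma decomposition_less_iff_same:
  assumes "is_perm \<sigma>" "is_decomposition \<pi> \<sigma> \<alpha>s" "i < length \<sigma>"
    and "p < length (\<alpha>s ! i)" "q < length (\<alpha>s ! i)"
  shows "\<pi> ! (seg_start \<alpha>s i + p) < \<pi> ! (seg_start \<alpha>s i + q) \<longleftrightarrow> \<alpha>s ! i ! p < \<alpha>s ! i ! q"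
  using is_inflation_less_iff[OF assms(1) decomposition_is_inflation[OF assms(1,2)]] assms by simp

lemma seg_start_in_segment:
  assumes "is_perm \<sigma>" "is_decomposition \<pi> \<sigma> \<alpha>s" "i < length \<sigma>"
  shows "seg_start \<alpha>s i \<in> segment \<alpha>s i"
  using decompositionD(5)[OF assms] by (simp add: segment_def)

lemma segment_bound:
  assumes "is_perm \<sigma>" "is_decomposition \<pi> \<sigma> \<alpha>s" "i < length \<sigma>" "p \<in> segment \<alpha>s i"
  shows "p < length \<pi>"
  using decompositionD(6)[OF assms(1-3)] assms(4) by (auto simp: is_block_def)

lemma segment_cases:
  assumes "is_perm \<sigma>" "is_decomposition \<pi> \<sigma> \<alpha>s" "p < length \<pi>"
  obtains i where "i < length \<sigma>" "p \<in> segment \<alpha>s i"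
  using assms(3) unfolding decompositionD(3)[OF assms(1,2)]
  by (elim seg_cases) (auto simp: segment_def)

lemma segment_less_mono:
  assumes "p \<in> segment \<alpha>s i" "q \<in> segment \<alpha>s j" "i < j"
  shows "p < q"
  using assms seg_start_mono[of "Suc i" j \<alpha>s] by (auto simp: segment_def seg_start_Suc)

lemma segment_index_mono:
  assumes "p \<in> segment \<alpha>s i" "q \<in> segment \<alpha>s j" "p \<le> q"
  shows "i \<le> j"
  using segment_less_mono[OF assms(2,1)] assms(3) by (meson not_le)

lemma segment_disjoint:
  assumes "p \<in> segment \<alpha>s i" "p \<in> segment \<alpha>s j"
  shows "i = j"
  using segment_index_mono[OF assms] segment_index_mono[OF assms(2,1)] by simp

lemma segment_proper:
  assumes "is_perm \<sigma>" "is_decomposition \<pi> \<sigma> \<alpha>s" "i < length \<sigma>" "2 \<le> length \<sigma>"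
  shows "segment \<alpha>s i \<noteq> {0..<length \<pi>}"
proof
  assume whole: "segment \<alpha>s i = {0..<length \<pi>}"
  define j :: nat where "j = (if i = 0 then 1 else 0)"
  have j: "j < length \<sigma>" "j \<noteq> i" using assms by (auto simp: j_def)
  have "seg_start \<alpha>s j \<in> segment \<alpha>s j" using seg_start_in_segment assms j by blast
  moreover from this have "seg_start \<alpha>s j \<in> segment \<alpha>s i"
    unfolding whole using segment_bound[OF assms(1,2) j(1)] by simp
  ultimately show False using segment_disjoint j by blast
qed

text \<open>
  An inflation is a permutation described by the relative order of its entries, and a permutation is
  determined by that order; so it suffices to compare entries within and across segments.
\<close>

lemma decompositionI:
  assumes \<pi>: "is_perm \<pi>" and \<sigma>: "is_perm \<sigma>" and \<alpha>s: "length \<alpha>s = length \<sigma>" "\<forall>\<alpha>\<in>set \<alpha>s. is_perm \<alpha>"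
    and len: "length \<pi> = seg_start \<alpha>s (length \<sigma>)"
    and same: "\<And>i p q. i < length \<sigma> \<Longrightarrow> p < length (\<alpha>s ! i) \<Longrightarrow> q < length (\<alpha>s ! i) \<Longrightarrow>
       \<pi> ! (seg_start \<alpha>s i + p) < \<pi> ! (seg_start \<alpha>s i + q) \<longleftrightarrow> \<alpha>s ! i ! p < \<alpha>s ! i ! q"
    and cross: "\<And>i j p q. i < length \<sigma> \<Longrightarrow> j < length \<sigma> \<Longrightarrow> i \<noteq> j \<Longrightarrow>
       p \<in> segment \<alpha>s i \<Longrightarrow> q \<in> segment \<alpha>s j \<Longrightarrow> \<pi> ! p < \<pi> ! q \<longleftrightarrow> \<sigma> ! i < \<sigma> ! j"
  shows "is_decomposition \<pi> \<sigma> \<alpha>s"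
proof -
  let ?\<tau> = "inflate \<sigma> \<alpha>s"
  have inf: "is_inflation \<sigma> \<alpha>s ?\<tau>"
    using is_inflation_inflation_list inflate_eq_inflation_list \<sigma> \<alpha>s by simp
  have "\<pi> = ?\<tau>"
  proof (rule perm_eqI[OF \<pi>])
    show "is_perm ?\<tau>" "length \<pi> = length ?\<tau>"
      using inf len by (auto simp: is_inflation_def seg_start_def)
    fix p q assume "p < length \<pi>" "q < length \<pi>"
    then obtain i p' j q' where *: "i < length \<sigma>" "p' < length (\<alpha>s ! i)" "p = seg_start \<alpha>s i + p'"
      "j < length \<sigma>" "q' < length (\<alpha>s ! j)" "q = seg_start \<alpha>s j + q'"
      unfolding len by (elim seg_cases)
    then have "p \<in> segment \<alpha>s i" "q \<in> segment \<alpha>s j" by (auto simp: segment_def)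
    then show "\<pi> ! p < \<pi> ! q \<longleftrightarrow> ?\<tau> ! p < ?\<tau> ! q"
      using same[of i p' q'] cross[of i j p q] is_inflation_less_iff[OF \<sigma> inf, of i p' j q'] *
      by (cases "i = j") simp_all
  qed
  then show ?thesis using \<alpha>s by (simp add: is_decomposition_def)
qed

lemma cuts_mono:
  fixes b :: "nat \<Rightarrow> nat"
  assumes "\<And>i. i < k \<Longrightarrow> b i < b (Suc i)" "i \<le> j" "j \<le> k"
  shows "b i \<le> b j"
  using assms(2,3)
proof (induction rule: dec_induct)
  case (step n)
  then show ?case using assms(1)[of n] by simp
qed simp

text \<open>
  The segments are the intervals between consecutive values of \<open>b\<close>. The parts are the standardized
  restrictions of \<open>\<pi>\<close> to them.
\<close>

lemma decomposition_from_cuts: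
  fixes b :: "nat \<Rightarrow> nat"
  assumes \<pi>: "is_perm \<pi>" and \<sigma>: "is_perm \<sigma>"
    and b0: "b 0 = 0" and bn: "b (length \<sigma>) = length \<pi>"
    and b_less: "\<And>i. i < length \<sigma> \<Longrightarrow> b i < b (Suc i)"
    and cross: "\<And>i j p q. i < length \<sigma> \<Longrightarrow> j < length \<sigma> \<Longrightarrow> i \<noteq> j \<Longrightarrow>
       p \<in> {b i..<b (Suc i)} \<Longrightarrow> q \<in> {b j..<b (Suc j)} \<Longrightarrow> \<pi> ! p < \<pi> ! q \<longleftrightarrow> \<sigma> ! i < \<sigma> ! j"
  obtains \<alpha>s where "is_decomposition \<pi> \<sigma> \<alpha>s" "\<And>i. i \<le> length \<sigma> \<Longrightarrow> seg_start \<alpha>s i = b i"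
proof -
  define k where "k = length \<sigma>"
  define piece where "piece i = take (b (Suc i) - b i) (drop (b i) \<pi>)" for i
  define \<alpha>s where "\<alpha>s = map (\<lambda>i. standardize (piece i)) [0..<k]"
  have b_mono: "b i \<le> b j" if "i \<le> j" "j \<le> k" for i j
    using cuts_mono[of k b i j] b_less that by (simp add: k_def)
  have len_piece: "length (piece i) = b (Suc i) - b i" if "i < k" for i
    using b_mono[of "Suc i" k] bn that by (simp add: piece_def k_def)
  have nth_piece: "piece i ! p = \<pi> ! (b i + p)" if "i < k" "p < b (Suc i) - b i" for i p
    using that b_mono[of "Suc i" k] bn by (simp add: piece_def k_def)
  have perm: "is_perm (standardize (piece i))" if "i < k" for i
  proof (rule is_perm_standardize)
    show "distinct (piece i)" using \<pi> by (simp add: piece_def is_perm_alt)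
    have "length (piece i) > 0" using len_piece[OF that] b_less that by (simp add: k_def)
    then show "piece i \<noteq> []" by simp
  qed
  have nth: "\<alpha>s ! i = standardize (piece i)" if "i < k" for i using that by (simp add: \<alpha>s_def)
  have start: "seg_start \<alpha>s i = b i" if "i \<le> k" for i
    using that
  proof (induction i)
    case 0
    then show ?case by (simp add: seg_start_def b0)
  next
    case (Suc i)
    then show ?case using b_mono[of i "Suc i"] by (simp add: seg_start_Suc nth len_piece)
  qed
  have seg: "segment \<alpha>s i = {b i..<b (Suc i)}" if "i < k" for i
    using start[of i] start[of "Suc i"] that by (simp add: segment_def seg_start_Suc)
  have "is_decomposition \<pi> \<sigma> \<alpha>s"
  proof (rule decompositionI[OF \<pi> \<sigma>])
    show "length \<alpha>s = length \<sigma>" by (simp add: \<alpha>s_def k_def)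
    show "\<forall>\<alpha>\<in>set \<alpha>s. is_perm \<alpha>" using perm by (auto simp: \<alpha>s_def)
    show "length \<pi> = seg_start \<alpha>s (length \<sigma>)" using start[of k] bn by (simp add: k_def)
  next
    fix i p q assume "i < length \<sigma>" "p < length (\<alpha>s ! i)" "q < length (\<alpha>s ! i)"
    then show "\<pi> ! (seg_start \<alpha>s i + p) < \<pi> ! (seg_start \<alpha>s i + q) \<longleftrightarrow> \<alpha>s ! i ! p < \<alpha>s ! i ! q"
      by (simp add: nth start standardize_less_iff nth_piece len_piece flip: k_def)
  next
    fix i j p q assume "i < length \<sigma>" "j < length \<sigma>" "i \<noteq> j" "p \<in> segment \<alpha>s i" "q \<in> segment \<alpha>s j"
    then show "\<pi> ! p < \<pi> ! q \<longleftrightarrow> \<sigma> ! i < \<sigma> ! j" using cross seg by (simp add: k_def)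
  qed
  then show ?thesis using that start by (simp add: k_def)
qed

text \<open>
  The relative order of two entries of the quotient can be read off from \<open>\<pi>\<close> at the starts of the
  corresponding segments, and that of two entries of a part from \<open>\<pi>\<close> inside the segment.
\<close>

lemma decomposition_determined_by_starts:
  assumes \<sigma>: "is_perm \<sigma>" "is_decomposition \<pi> \<sigma> \<alpha>s"
    and \<tau>: "is_perm \<tau>" "is_decomposition \<pi> \<tau> \<beta>s"
    and k: "length \<sigma> = length \<tau>"
    and starts: "\<And>i. i \<le> length \<sigma> \<Longrightarrow> seg_start \<alpha>s i = seg_start \<beta>s i"
  shows "\<sigma> = \<tau> \<and> \<alpha>s = \<beta>s"
proof
  have len: "length (\<alpha>s ! i) = length (\<beta>s ! i)" if "i < length \<sigma>" for i
    using starts[of i] starts[of "Suc i"] that by (simp add: seg_start_Suc)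
  show "\<sigma> = \<tau>"
  proof (rule perm_eqI[OF \<sigma>(1) \<tau>(1) k])
    fix i j assume ij: "i < length \<sigma>" "j < length \<sigma>"
    let ?p = "seg_start \<alpha>s i" and ?q = "seg_start \<alpha>s j"
    show "\<sigma> ! i < \<sigma> ! j \<longleftrightarrow> \<tau> ! i < \<tau> ! j"
    proof (cases "i = j")
      case False
      have "\<pi> ! ?p < \<pi> ! ?q \<longleftrightarrow> \<sigma> ! i < \<sigma> ! j"
        using decomposition_less_iff[OF \<sigma> ij False] seg_start_in_segment[OF \<sigma>] ij by simp
      moreover have "\<pi> ! ?p < \<pi> ! ?q \<longleftrightarrow> \<tau> ! i < \<tau> ! j"
        using decomposition_less_iff[OF \<tau> _ _ False] seg_start_in_segment[OF \<tau>] ij k starts by simp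
      ultimately show ?thesis by simp
    qed simp
  qed
  show "\<alpha>s = \<beta>s"
  proof (rule nth_equalityI)
    show "length \<alpha>s = length \<beta>s" using decompositionD(2) \<sigma> \<tau> k by metis
    fix i assume "i < length \<alpha>s"
    then have i: "i < length \<sigma>" "i < length \<tau>" using decompositionD(2)[OF \<sigma>] k by auto
    show "\<alpha>s ! i = \<beta>s ! i"
    proof (rule perm_eqI)
      show "is_perm (\<alpha>s ! i)" "is_perm (\<beta>s ! i)" using decompositionD(4) \<sigma> \<tau> i by blast+
      show "length (\<alpha>s ! i) = length (\<beta>s ! i)" using len i by simp
      fix p q assume "p < length (\<alpha>s ! i)" "q < length (\<alpha>s ! i)"
      then show "\<alpha>s ! i ! p < \<alpha>s ! i ! q \<longleftrightarrow> \<beta>s ! i ! p < \<beta>s ! i ! q"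
        using decomposition_less_iff_same[OF \<sigma> i(1)] decomposition_less_iff_same[OF \<tau> i(2)]
          starts[of i] len[of i] i by simp
    qed
  qed
qed

text \<open>
  The set of segments already determines their order: their starts are the minima, and they are
  enumerated increasingly.
\<close>

lemma decomposition_determined_by_segments:
  assumes \<sigma>: "is_perm \<sigma>" "is_decomposition \<pi> \<sigma> \<alpha>s"
    and \<tau>: "is_perm \<tau>" "is_decomposition \<pi> \<tau> \<beta>s"
    and segs: "segment \<alpha>s ` {..<length \<sigma>} = segment \<beta>s ` {..<length \<tau>}"
  shows "\<sigma> = \<tau> \<and> \<alpha>s = \<beta>s"
proof -
  have starts: "set (map (seg_start \<gamma>s) [0..<length \<rho>]) = Min ` segment \<gamma>s ` {..<length \<rho>}"
    and sorted: "sorted_wrt (<) (map (seg_start \<gamma>s) [0..<length \<rho>])"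
    if \<rho>: "is_perm \<rho>" "is_decomposition \<pi> \<rho> \<gamma>s" for \<rho> \<gamma>s
  proof -
    have "Min (segment \<gamma>s i) = seg_start \<gamma>s i" if "i < length \<rho>" for i
      using seg_start_in_segment[OF \<rho> that] by (intro Min_eqI) (auto simp: segment_def)
    then show "set (map (seg_start \<gamma>s) [0..<length \<rho>]) = Min ` segment \<gamma>s ` {..<length \<rho>}"
      by (auto simp: image_image atLeast0LessThan)
    show "sorted_wrt (<) (map (seg_start \<gamma>s) [0..<length \<rho>])"
      using segment_less_mono[OF seg_start_in_segment[OF \<rho>] seg_start_in_segment[OF \<rho>]]
      by (simp add: sorted_wrt_iff_nth_less)
  qed
  have eq: "map (seg_start \<alpha>s) [0..<length \<sigma>] = map (seg_start \<beta>s) [0..<length \<tau>]"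
    using sorted[OF \<sigma>] sorted[OF \<tau>] starts[OF \<sigma>] starts[OF \<tau>] segs
    by (intro sorted_distinct_set_unique) (auto simp: strict_sorted_iff)
  then have k: "length \<sigma> = length \<tau>" using map_eq_imp_length_eq by fastforce
  have "seg_start \<alpha>s i = seg_start \<beta>s i" if "i < length \<sigma>" for i
    using arg_cong[OF eq, of "\<lambda>xs. xs ! i"] that k by simp
  moreover have "seg_start \<alpha>s (length \<sigma>) = seg_start \<beta>s (length \<sigma>)"
    using decompositionD(3)[OF \<sigma>] decompositionD(3)[OF \<tau>] k by simp
  ultimately show ?thesis
    using decomposition_determined_by_starts[OF \<sigma> \<tau> k] by (metis le_neq_implies_less)
qed

section \<open>Existence of a simple quotient\<close>

lemma trivial_decomposition:
  assumes "is_perm \<pi>"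
  shows "\<exists>\<alpha>s. is_decomposition \<pi> \<pi> \<alpha>s"
  by (rule decomposition_from_cuts[OF assms assms, of "\<lambda>i. i"]) auto

text \<open>
  The quotient is the pattern of \<open>\<pi>\<close> at the starts of the intervals. It is independent of this choice
  of representatives: in comparing \<open>\<pi> ! p\<close> with \<open>\<pi> ! q\<close>, each of the two positions may be moved
  to the start of its interval because that interval is a module and the other position lies outside.
\<close>

lemma decomposition_from_module_cuts:
  fixes b :: "nat \<Rightarrow> nat"
  assumes \<pi>: "is_perm \<pi>" and k: "0 < k"
    and b: "b 0 = 0" "b k = length \<pi>" "\<And>i. i < k \<Longrightarrow> b i < b (Suc i)"
    and modules: "\<And>i. i < k \<Longrightarrow> order_module \<pi> {b i..<b (Suc i)}"
  obtains \<sigma> \<alpha>s where "is_perm \<sigma>" "length \<sigma> = k" "is_decomposition \<pi> \<sigma> \<alpha>s"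
proof -
  have b_mono: "b i \<le> b j" if "i \<le> j" "j \<le> k" for i j
    using cuts_mono[of k b i j] b(3) that by simp
  have disj: "i = j" if "i < k" "j < k" "p \<in> {b i..<b (Suc i)}" "p \<in> {b j..<b (Suc j)}" for i j p
    using that b_mono[of "Suc i" j] b_mono[of "Suc j" i] by (cases i j rule: linorder_cases) auto
  have bound: "p < length \<pi>" if "i < k" "p \<in> {b i..<b (Suc i)}" for i p
    using b_mono[of "Suc i" k] b(2) that by auto
  have start: "b i \<in> {b i..<b (Suc i)}" if "i < k" for i using b(3)[OF that] by simp
  define \<sigma> where "\<sigma> = standardize (map (\<lambda>i. \<pi> ! b i) [0..<k])"
  have len: "length \<sigma> = k" by (simp add: \<sigma>_def)
  have \<sigma>: "is_perm \<sigma>"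
    unfolding \<sigma>_def
  proof (rule is_perm_standardize)
    have "b i \<noteq> b j" if "i < k" "j < k" "i \<noteq> j" for i j
      using disj[of i j "b i"] start that by auto
    then show "distinct (map (\<lambda>i. \<pi> ! b i) [0..<k])"
      using is_perm_nth_eq_iff[OF \<pi> bound[OF _ start] bound[OF _ start]]
      by (simp add: distinct_conv_nth)
  qed (use k in simp)
  have "\<pi> ! p < \<pi> ! q \<longleftrightarrow> \<sigma> ! i < \<sigma> ! j"
    if ij: "i < k" "j < k" "i \<noteq> j" and p: "p \<in> {b i..<b (Suc i)}" and q: "q \<in> {b j..<b (Suc j)}"
    for i j p q
  proof -
    note bd = bound[OF ij(1) p] bound[OF ij(2) q] bound[OF ij(1) start[OF ij(1)]]
      bound[OF ij(2) start[OF ij(2)]]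
    \<comment> \<open>Modules only allow moving the right argument of the comparison, so the left one is moved
      after negation; the entries differ because their positions lie in different intervals.\<close>
    have "\<pi> ! p < \<pi> ! q \<longleftrightarrow> \<pi> ! p < \<pi> ! b j"
      using modules[OF ij(2)] q start[OF ij(2)] bd disj[OF ij(1,2) p] ij(3)
      unfolding order_module_def by blast
    also have "\<dots> \<longleftrightarrow> \<not> \<pi> ! b j < \<pi> ! p"
      using is_perm_nth_eq_iff[OF \<pi> bd(1,4)] disj[OF ij(1,2) p] start ij by auto
    also have "\<pi> ! b j < \<pi> ! p \<longleftrightarrow> \<pi> ! b j < \<pi> ! b i"
      using modules[OF ij(1)] p start[OF ij(1)] bd disj[OF ij(2,1) start[OF ij(2)]] ij(3)
      unfolding order_module_def by blast
    also have "\<not> \<pi> ! b j < \<pi> ! b i \<longleftrightarrow> \<pi> ! b i < \<pi> ! b j"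
      using is_perm_nth_eq_iff[OF \<pi> bd(3,4)] disj[OF ij(1,2) start[OF ij(1)]] start ij by auto
    also have "\<dots> \<longleftrightarrow> \<sigma> ! i < \<sigma> ! j"
      using ij by (simp add: \<sigma>_def standardize_less_iff)
    finally show ?thesis .
  qed
  then obtain \<alpha>s where "is_decomposition \<pi> \<sigma> \<alpha>s"
    using decomposition_from_cuts[OF \<pi> \<sigma>, of b] b unfolding len by blast
  then show ?thesis using that \<sigma> len by blast
qed

lemma order_module_union_segments:
  assumes \<sigma>: "is_perm \<sigma>" "is_decomposition \<pi> \<sigma> \<alpha>s"
    and J: "order_module \<sigma> {a..c}" "a \<le> c" "c < length \<sigma>"
  shows "order_module \<pi> {seg_start \<alpha>s a..<seg_start \<alpha>s (Suc c)}"
proof -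
  have index: "seg_start \<alpha>s a \<le> p \<and> p < seg_start \<alpha>s (Suc c) \<longleftrightarrow> i \<in> {a..c}"
    if "p \<in> segment \<alpha>s i" for i p
    using seg_start_mono[of a i \<alpha>s] seg_start_mono[of "Suc i" "Suc c" \<alpha>s]
      seg_start_mono[of "Suc i" a \<alpha>s] seg_start_mono[of "Suc c" i \<alpha>s] that
    by (force simp: segment_def seg_start_Suc)
  have bound: "seg_start \<alpha>s (Suc c) \<le> length \<pi>"
    using J(3) decompositionD(3)[OF \<sigma>] seg_start_mono[of "Suc c" "length \<sigma>" \<alpha>s] by simp
  show ?thesis
    unfolding order_module_def
  proof (intro ballI allI impI)
    fix p q x
    assume p: "p \<in> {seg_start \<alpha>s a..<seg_start \<alpha>s (Suc c)}"
      and q: "q \<in> {seg_start \<alpha>s a..<seg_start \<alpha>s (Suc c)}"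
      and x: "x < length \<pi>" "x \<notin> {seg_start \<alpha>s a..<seg_start \<alpha>s (Suc c)}"
    obtain i where i: "i < length \<sigma>" "p \<in> segment \<alpha>s i"
      using p bound segment_cases[OF \<sigma>, of p] by auto
    obtain j where j: "j < length \<sigma>" "q \<in> segment \<alpha>s j"
      using q bound segment_cases[OF \<sigma>, of q] by auto
    obtain l where l: "l < length \<sigma>" "x \<in> segment \<alpha>s l"
      using x(1) segment_cases[OF \<sigma>] by auto
    have ijl: "i \<in> {a..c}" "j \<in> {a..c}" "l \<notin> {a..c}"
      using index[OF i(2)] index[OF j(2)] index[OF l(2)] p q x by auto
    have "\<pi> ! x < \<pi> ! p \<longleftrightarrow> \<sigma> ! l < \<sigma> ! i"
      using ijl i l by (intro decomposition_less_iff[OF \<sigma>]) auto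
    also have "\<dots> \<longleftrightarrow> \<sigma> ! l < \<sigma> ! j" using J(1) ijl l unfolding order_module_def by blast
    also have "\<dots> \<longleftrightarrow> \<pi> ! x < \<pi> ! q"
      using ijl j l by (intro decomposition_less_iff[OF \<sigma>, symmetric]) auto
    finally show "\<pi> ! x < \<pi> ! p \<longleftrightarrow> \<pi> ! x < \<pi> ! q" .
  qed
qed

text \<open>
  The segments with indices in the block become one segment, which is a module by
  \<open>order_module_union_segments\<close>; the other segments are kept.
\<close>

lemma merge_block:
  assumes \<sigma>: "is_perm \<sigma>" "is_decomposition \<pi> \<sigma> \<alpha>s"
    and J: "is_block \<sigma> {a..c}" "a < c" "c < length \<sigma>" and proper: "\<not> (a = 0 \<and> c = length \<sigma> - 1)"
  obtains \<tau> \<beta>s where "is_perm \<tau>" "2 \<le> length \<tau>" "length \<tau> < length \<sigma>" "is_decomposition \<pi> \<tau> \<beta>s"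
proof -
  define d where "d = c - a"
  define k where "k = length \<sigma> - d"
  \<comment> \<open>The cuts at \<open>a + 1, \<dots>, c\<close> are skipped.\<close>
  define b where "b i = seg_start \<alpha>s (if i \<le> a then i else i + d)" for i
  have \<pi>: "is_perm \<pi>" using decompositionD(1)[OF \<sigma>] .
  have k: "2 \<le> k" "k < length \<sigma>" "a < k" using J proper by (auto simp: k_def d_def)
  have less: "seg_start \<alpha>s i < seg_start \<alpha>s j" if "i < j" "j \<le> length \<sigma>" for i j
    using that seg_bound[of i j 0 \<alpha>s] decompositionD(5)[OF \<sigma>, of i] by simp
  have b0: "b 0 = 0" by (simp add: b_def seg_start_def)
  have bk: "b k = length \<pi>" using k J decompositionD(3)[OF \<sigma>] by (simp add: b_def k_def d_def)
  have b_less: "b i < b (Suc i)" if "i < k" for i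
    using that k by (auto simp: b_def k_def d_def intro!: less)
  have modules: "order_module \<pi> {b i..<b (Suc i)}" if i: "i < k" for i
  proof (cases "i = a")
    case True
    have "order_module \<pi> {seg_start \<alpha>s a..<seg_start \<alpha>s (Suc c)}"
      using order_module_union_segments[OF \<sigma>] is_block_imp_order_module[OF \<sigma>(1) J(1)] J by simp
    then show ?thesis using True J by (simp add: b_def d_def)
  next
    case False
    define j where "j = (if i \<le> a then i else i + d)"
    have "j < length \<sigma>" using i k by (auto simp: j_def k_def)
    then have "order_module \<pi> (segment \<alpha>s j)"
      using decompositionD(6)[OF \<sigma>] is_block_imp_order_module[OF \<pi>] by blast
    moreover have "segment \<alpha>s j = {b i..<b (Suc i)}"
      using False by (simp add: segment_def seg_start_Suc[symmetric] b_def j_def)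
    ultimately show ?thesis by simp
  qed
  obtain \<tau> \<beta>s where "is_perm \<tau>" "length \<tau> = k" "is_decomposition \<pi> \<tau> \<beta>s"
    using decomposition_from_module_cuts[OF \<pi>, of k b] b0 bk b_less modules k(3) by blast
  then show ?thesis using that k by blast
qed

text \<open>
  Among the decompositions into at least two segments, one with the fewest segments has a simple
  quotient.
\<close>

lemma simple_decomposition_exists:
  assumes "is_perm \<pi>" "2 \<le> length \<pi>"
  shows "\<exists>\<sigma>. is_simple \<sigma> \<and> 2 \<le> length \<sigma> \<and> (\<exists>\<alpha>s. is_decomposition \<pi> \<sigma> \<alpha>s)"
proof -
  define P where "P \<sigma> \<longleftrightarrow> is_perm \<sigma> \<and> 2 \<le> length \<sigma> \<and> (\<exists>\<alpha>s. is_decomposition \<pi> \<sigma> \<alpha>s)" for \<sigma>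
  have "P \<pi>" unfolding P_def using assms trivial_decomposition by blast
  then obtain \<sigma> where P: "P \<sigma>" and least: "\<And>\<tau>. P \<tau> \<Longrightarrow> length \<sigma> \<le> length \<tau>"
    using ex_has_least_nat[of P \<pi> length] by blast
  then obtain \<alpha>s where \<sigma>: "is_perm \<sigma>" "is_decomposition \<pi> \<sigma> \<alpha>s" by (auto simp: P_def)
  have "(\<exists>p. I = {p}) \<or> I = {0..<length \<sigma>}" if block: "is_block \<sigma> I" for I
  proof (rule ccontr)
    assume neg: "\<not> ?thesis"
    obtain a c where ac: "a \<le> c" "c < length \<sigma>" "I = {a..c}"
      using block unfolding is_block_def by blast
    then have "a < c" using neg by (cases "a = c") auto
    moreover have "\<not> (a = 0 \<and> c = length \<sigma> - 1)" using neg ac by force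
    ultimately obtain \<tau> \<beta>s where "is_perm \<tau>" "2 \<le> length \<tau>" "length \<tau> < length \<sigma>"
      "is_decomposition \<pi> \<tau> \<beta>s"
      using merge_block[OF \<sigma>] ac block by metis
    then show False using least[of \<tau>] by (auto simp: P_def)
  qed
  then show ?thesis using P \<sigma>(1) by (auto simp: P_def is_simple_def)
qed

section \<open>Uniqueness for quotients of length greater than two\<close>

text \<open>
  A comparison of \<open>\<sigma> ! l\<close> with \<open>\<sigma> ! i\<close> can be tested on any representatives of the segments \<open>l\<close> and
  \<open>i\<close>; the hypotheses allow choosing them outside and inside \<open>B\<close>, respectively. The freedom in \<open>J\<close>
  matters: a segment that is met by \<open>B\<close> but not contained in it may be counted in \<open>J\<close> or not.
\<close>

lemma project_module:
  assumes \<sigma>: "is_perm \<sigma>" "is_decomposition \<pi> \<sigma> \<alpha>s" and B: "order_module \<pi> B"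
    and J: "J \<subseteq> {..<length \<sigma>}"
    and meets: "\<And>i. i \<in> J \<Longrightarrow> segment \<alpha>s i \<inter> B \<noteq> {}"
    and sticks_out: "\<And>i. i < length \<sigma> \<Longrightarrow> i \<notin> J \<Longrightarrow> \<not> segment \<alpha>s i \<subseteq> B"
  shows "order_module \<sigma> J"
  unfolding order_module_def
proof (intro ballI allI impI)
  fix i j l assume ij: "i \<in> J" "j \<in> J" and l: "l < length \<sigma>" "l \<notin> J"
  obtain p where p: "p \<in> segment \<alpha>s i" "p \<in> B" using meets[OF ij(1)] by blast
  obtain q where q: "q \<in> segment \<alpha>s j" "q \<in> B" using meets[OF ij(2)] by blast
  obtain x where x: "x \<in> segment \<alpha>s l" "x \<notin> B" using sticks_out[OF l] by blast
  have "\<sigma> ! l < \<sigma> ! i \<longleftrightarrow> \<pi> ! x < \<pi> ! p"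
    using ij l J p x by (intro decomposition_less_iff[OF \<sigma>, symmetric]) auto
  also have "\<dots> \<longleftrightarrow> \<pi> ! x < \<pi> ! q"
    using B p q x segment_bound[OF \<sigma> l(1) x(1)] unfolding order_module_def by blast
  also have "\<dots> \<longleftrightarrow> \<sigma> ! l < \<sigma> ! j"
    using ij l J q x by (intro decomposition_less_iff[OF \<sigma>]) auto
  finally show "\<sigma> ! l < \<sigma> ! i \<longleftrightarrow> \<sigma> ! l < \<sigma> ! j" .
qed

text \<open>
  The indices of the segments met by \<open>B\<close> form a block of the simple \<open>\<sigma>\<close>. If this is everything,
  an end position of \<open>\<pi>\<close> missing from \<open>B\<close> shows that the segment at that end can be
  left out of the index set, and the remaining indices form a nontrivial block.
\<close>

lemma proper_block_in_segment:
  assumes simple: "is_simple \<sigma>" and k: "2 < length \<sigma>" and dec: "is_decomposition \<pi> \<sigma> \<alpha>s"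
    and B: "is_block \<pi> B" "B \<noteq> {0..<length \<pi>}"
  obtains i where "i < length \<sigma>" "B \<subseteq> segment \<alpha>s i"
proof -
  have \<sigma>: "is_perm \<sigma>" "is_decomposition \<pi> \<sigma> \<alpha>s" using simple dec by (auto simp: is_simple_def)
  have module: "order_module \<pi> B"
    using is_block_imp_order_module[OF decompositionD(1)[OF \<sigma>] B(1)] .
  obtain a c where ac: "a \<le> c" "c < length \<pi>" "B = {a..c}"
    using B(1) unfolding is_block_def by (elim conjE exE)
  obtain i where i: "i < length \<sigma>" "a \<in> segment \<alpha>s i" using segment_cases[OF \<sigma>, of a] ac by auto
  obtain j where j: "j < length \<sigma>" "c \<in> segment \<alpha>s j" using segment_cases[OF \<sigma>, of c] ac by auto
  have ij: "i \<le> j" using segment_index_mono i j ac by blast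
  have B_index: "l \<in> {i..j}" if "p \<in> segment \<alpha>s l" "p \<in> B" for p l
    using segment_index_mono[OF i(2) that(1)] segment_index_mono[OF that(1) j(2)] that(2) ac by auto
  have meets: "segment \<alpha>s l \<inter> B \<noteq> {}" if l: "l \<in> {i..j}" for l
  proof -
    consider "l = i" | "l = j" | "i < l" "l < j" using l by fastforce
    then show ?thesis
    proof cases
      case 3
      have s: "seg_start \<alpha>s l \<in> segment \<alpha>s l" using seg_start_in_segment[OF \<sigma>] 3 j by simp
      then have "a < seg_start \<alpha>s l" "seg_start \<alpha>s l < c"
        using segment_less_mono i j 3 by blast+
      then show ?thesis using s ac by auto
    qed (use i j ac in auto)
  qed
  have "order_module \<sigma> {i..j}"
  proof (rule project_module[OF \<sigma> module _ meets])
    show "\<not> segment \<alpha>s l \<subseteq> B" if "l < length \<sigma>" "l \<notin> {i..j}" for l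
      using B_index seg_start_in_segment[OF \<sigma> that(1)] that(2) by blast
  qed (use j in auto)
  then consider "i = j" | "i = 0" "j = length \<sigma> - 1"
    using is_simple_order_module[OF simple ij j(1)] by blast
  then show ?thesis
  proof cases
    case 1
    have "p \<in> segment \<alpha>s i" if "p \<in> B" for p
    proof -
      have "p < length \<pi>" using that ac by auto
      then obtain l where "p \<in> segment \<alpha>s l" using segment_cases[OF \<sigma>] by blast
      then show ?thesis using B_index that 1 by fastforce
    qed
    then show ?thesis using that i by blast
  next
    case 2
    have "0 < length \<pi>" using ac(2) by linarith
    obtain f where f: "f < length \<sigma>" "0 \<in> segment \<alpha>s f"
      using segment_cases[OF \<sigma> \<open>0 < length \<pi>\<close>] by blast
    then have first: "0 \<in> segment \<alpha>s 0"
      using segment_index_mono[OF f(2) i(2)] 2 by simp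
    obtain g where g: "g < length \<sigma>" "length \<pi> - 1 \<in> segment \<alpha>s g"
      using segment_cases[OF \<sigma>, of "length \<pi> - 1"] \<open>0 < length \<pi>\<close> by auto
    have "c \<le> length \<pi> - 1" using ac(2) by linarith
    then have "j \<le> g" using segment_index_mono[OF j(2) g(2)] by blast
    then have "g = length \<sigma> - 1" using 2(2) g(1) by linarith
    then have last: "length \<pi> - 1 \<in> segment \<alpha>s (length \<sigma> - 1)" using g by simp
    consider "0 \<notin> B" | "length \<pi> - 1 \<notin> B" using B(2) ac by force
    then show ?thesis
    proof cases
      case 1
      have "order_module \<sigma> {1..length \<sigma> - 1}"
      proof (rule project_module[OF \<sigma> module])
        show "\<not> segment \<alpha>s l \<subseteq> B" if "l < length \<sigma>" "l \<notin> {1..length \<sigma> - 1}" for l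
          using 1 first that by (cases l) auto
      qed (use meets k 2 in auto)
      moreover have "1 \<le> length \<sigma> - 1" "length \<sigma> - 1 < length \<sigma>" using k by linarith+
      ultimately have "1 = length \<sigma> - 1"
        using is_simple_order_module[OF simple, of 1 "length \<sigma> - 1"] by linarith
      then show ?thesis using k by linarith
    next
      case 2: 2
      have "order_module \<sigma> {0..length \<sigma> - 2}"
      proof (rule project_module[OF \<sigma> module])
        show "\<not> segment \<alpha>s l \<subseteq> B" if "l < length \<sigma>" "l \<notin> {0..length \<sigma> - 2}" for l
        proof -
          have "l = length \<sigma> - 1" using that by auto
          then show ?thesis using 2 last by blast
        qed
      qed (use meets k \<open>i = 0\<close> \<open>j = length \<sigma> - 1\<close> in auto)
      moreover have "length \<sigma> - 2 < length \<sigma>" using k by linarith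
      ultimately have "0 = length \<sigma> - 2 \<or> length \<sigma> - 2 = length \<sigma> - 1"
        using is_simple_order_module[OF simple, of 0 "length \<sigma> - 2"] by blast
      then show ?thesis using k by linarith
    qed
  qed
qed

lemma segments_refine:
  assumes \<sigma>: "is_simple \<sigma>" "2 < length \<sigma>" "is_decomposition \<pi> \<sigma> \<alpha>s"
    and \<tau>: "is_perm \<tau>" "2 \<le> length \<tau>" "is_decomposition \<pi> \<tau> \<beta>s" and j: "j < length \<tau>"
  shows "\<exists>i<length \<sigma>. segment \<beta>s j \<subseteq> segment \<alpha>s i"
  using proper_block_in_segment[OF \<sigma> decompositionD(6)[OF \<tau>(1,3) j] segment_proper[OF \<tau>(1,3) j \<tau>(2)]]
  by blast

text \<open>
  Each segment of the first decomposition contains a segment of the second, namely any one that it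
  meets.
\<close>

lemma simple_quotient_length_le:
  assumes \<sigma>: "is_simple \<sigma>" "2 < length \<sigma>" "is_decomposition \<pi> \<sigma> \<alpha>s"
    and \<tau>: "is_perm \<tau>" "2 \<le> length \<tau>" "is_decomposition \<pi> \<tau> \<beta>s"
  shows "length \<sigma> \<le> length \<tau>"
proof -
  have \<sigma>': "is_perm \<sigma>" using \<sigma>(1) by (simp add: is_simple_def)
  obtain f where f: "\<And>j. j < length \<tau> \<Longrightarrow> f j < length \<sigma> \<and> segment \<beta>s j \<subseteq> segment \<alpha>s (f j)"
    using segments_refine[OF \<sigma> \<tau>] by metis
  have "{..<length \<sigma>} \<subseteq> f ` {..<length \<tau>}"
  proof
    fix i assume "i \<in> {..<length \<sigma>}"
    then have s: "seg_start \<alpha>s i \<in> segment \<alpha>s i" "seg_start \<alpha>s i < length \<pi>"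
      using seg_start_in_segment[OF \<sigma>' \<sigma>(3)] segment_bound[OF \<sigma>' \<sigma>(3)] by auto
    then obtain j where j: "j < length \<tau>" "seg_start \<alpha>s i \<in> segment \<beta>s j"
      using segment_cases[OF \<tau>(1,3)] by blast
    then have "f j = i" using f[OF j(1)] s(1) segment_disjoint by blast
    then show "i \<in> f ` {..<length \<tau>}" using j(1) by blast
  qed
  then show ?thesis
    using card_mono[of "f ` {..<length \<tau>}" "{..<length \<sigma>}"] card_image_le[of "{..<length \<tau>}" f] by simp
qed

text \<open>
  By \<open>simple_quotient_length_le\<close> both quotients have length greater than 2, so every segment of either
  decomposition lies in a segment of the other. Going back and forth leads from a segment to one that
  contains it, hence to itself, as the segments of one decomposition are disjoint.
\<close>

lemma simple_decomposition_unique: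
  assumes \<sigma>: "is_simple \<sigma>" "2 < length \<sigma>" "is_decomposition \<pi> \<sigma> \<alpha>s"
    and \<tau>: "is_simple \<tau>" "2 \<le> length \<tau>" "is_decomposition \<pi> \<tau> \<beta>s"
  shows "\<sigma> = \<tau> \<and> \<alpha>s = \<beta>s"
proof -
  have perm: "is_perm \<sigma>" "is_perm \<tau>" using \<sigma>(1) \<tau>(1) by (auto simp: is_simple_def)
  have \<tau>_long: "2 < length \<tau>"
    using simple_quotient_length_le[OF \<sigma> perm(2) \<tau>(2,3)] \<sigma>(2) by simp
  have sub: "segment \<alpha>s ` {..<length \<sigma>} \<subseteq> segment \<beta>s ` {..<length \<tau>}"
    if \<sigma>: "is_simple \<sigma>" "2 < length \<sigma>" "is_decomposition \<pi> \<sigma> \<alpha>s"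
      and \<tau>: "is_simple \<tau>" "2 < length \<tau>" "is_decomposition \<pi> \<tau> \<beta>s" for \<sigma> \<tau> \<alpha>s \<beta>s
  proof (intro image_subsetI)
    fix i assume i: "i \<in> {..<length \<sigma>}"
    have perm: "is_perm \<sigma>" "is_perm \<tau>" using \<sigma>(1) \<tau>(1) by (auto simp: is_simple_def)
    obtain j where j: "j < length \<tau>" "segment \<alpha>s i \<subseteq> segment \<beta>s j"
      using segments_refine[OF \<tau> perm(1) _ \<sigma>(3), of i] \<sigma>(2) i by auto
    obtain l where l: "l < length \<sigma>" "segment \<beta>s j \<subseteq> segment \<alpha>s l"
      using segments_refine[OF \<sigma> perm(2) _ \<tau>(3) j(1)] \<tau>(2) by auto
    have "seg_start \<alpha>s i \<in> segment \<alpha>s i" using seg_start_in_segment[OF perm(1) \<sigma>(3)] i by simp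
    then have "l = i" using j l segment_disjoint by blast
    then have "segment \<alpha>s i = segment \<beta>s j" using j l by blast
    then show "segment \<alpha>s i \<in> segment \<beta>s ` {..<length \<tau>}" using j(1) by blast
  qed
  have "segment \<alpha>s ` {..<length \<sigma>} = segment \<beta>s ` {..<length \<tau>}"
    using sub[OF \<sigma> \<tau>(1) \<tau>_long \<tau>(3)] sub[OF \<tau>(1) \<tau>_long \<tau>(3) \<sigma>] by blast
  then show ?thesis
    using decomposition_determined_by_segments[OF perm(1) \<sigma>(3) perm(2) \<tau>(3)] by blast
qed

section \<open>Quotients of length two\<close>

lemma is_perm_length_2:
  assumes "is_perm \<sigma>" "length \<sigma> = 2"
  shows "\<sigma> = [1, 2] \<or> \<sigma> = [2, 1]"
proof -
  obtain x y where xy: "\<sigma> = [x, y]" using assms(2) by (auto simp: length_Suc_conv numeral_2_eq_2)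
  have "{x, y} = {1..2}" "x \<noteq> y" using assms(1) xy by (simp_all add: is_perm_alt numeral_2_eq_2)
  moreover have "{1..2} = {1, 2::nat}" by auto
  ultimately show ?thesis using xy by (simp add: doubleton_eq_iff)
qed

text \<open>
  The two quotients of length 2 are treated together: \<open>\<sigma>\<close> is \<open>12\<close> or \<open>21\<close>, and the truth value of
  \<open>\<sigma> ! 0 < \<sigma> ! 1\<close> tells which of the two comparisons is required across the cut.
\<close>

definition splits_at :: "nat list \<Rightarrow> nat list \<Rightarrow> nat \<Rightarrow> bool" where
  "splits_at \<sigma> \<pi> m \<longleftrightarrow> 0 < m \<and> m < length \<pi> \<and>
     (\<forall>p<m. \<forall>q\<in>{m..<length \<pi>}. \<pi> ! p < \<pi> ! q \<longleftrightarrow> \<sigma> ! 0 < \<sigma> ! 1)"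

text \<open>
  Plus indecomposability for \<open>\<sigma> = 12\<close> and minus indecomposability for \<open>\<sigma> = 21\<close>.
\<close>

definition indecomposable_by :: "nat list \<Rightarrow> nat list \<Rightarrow> bool" where
  "indecomposable_by \<sigma> \<pi> \<longleftrightarrow>
     \<not> (\<exists>\<alpha> \<beta>. is_perm \<alpha> \<and> is_perm \<beta> \<and> \<pi> = inflate \<sigma> [\<alpha>, \<beta>])"

lemma seg_start_1: "seg_start \<alpha>s (Suc 0) = length (\<alpha>s ! 0)"
  by (simp add: seg_start_def)

lemma seg_start_0: "seg_start \<alpha>s 0 = 0"
  by (simp add: seg_start_def)

lemma splits_at_decomposition:
  assumes \<sigma>: "is_perm \<sigma>" "is_decomposition \<pi> \<sigma> \<alpha>s" and k: "length \<sigma> = 2"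
  shows "splits_at \<sigma> \<pi> (length (\<alpha>s ! 0))"
proof -
  have len: "length \<pi> = length (\<alpha>s ! 0) + length (\<alpha>s ! 1)"
    using decompositionD(3)[OF \<sigma>] k by (simp add: seg_start_def numeral_2_eq_2)
  have pos: "0 < length (\<alpha>s ! 0)" "0 < length (\<alpha>s ! 1)" using decompositionD(5)[OF \<sigma>] k by auto
  have "\<pi> ! p < \<pi> ! q \<longleftrightarrow> \<sigma> ! 0 < \<sigma> ! 1"
    if "p < length (\<alpha>s ! 0)" "q \<in> {length (\<alpha>s ! 0)..<length \<pi>}" for p q
    using that len k
    by (intro decomposition_less_iff[OF \<sigma>]) (auto simp: segment_def seg_start_0 seg_start_1)
  then show ?thesis using len pos by (auto simp: splits_at_def)
qed

lemma decomposition_of_splits_at: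
  assumes \<pi>: "is_perm \<pi>" and \<sigma>: "is_perm \<sigma>" "length \<sigma> = 2" and m: "splits_at \<sigma> \<pi> m"
  obtains \<alpha>s where "is_decomposition \<pi> \<sigma> \<alpha>s" "length (\<alpha>s ! 0) = m"
proof -
  define b where "b i = (if i = 0 then 0 else if i = 1 then m else length \<pi>)" for i :: nat
  have m_bound: "0 < m" "m < length \<pi>"
    and less: "\<And>p q. p < m \<Longrightarrow> q \<in> {m..<length \<pi>} \<Longrightarrow> \<pi> ! p < \<pi> ! q \<longleftrightarrow> \<sigma> ! 0 < \<sigma> ! 1"
    using m by (auto simp: splits_at_def)
  have flip: "\<pi> ! q < \<pi> ! p \<longleftrightarrow> \<sigma> ! 1 < \<sigma> ! 0" if "p < m" "q \<in> {m..<length \<pi>}" for p q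
    using less[OF that] is_perm_nth_eq_iff[OF \<pi>, of p q] is_perm_nth_eq_iff[OF \<sigma>(1), of 0 1] that \<sigma>(2)
    by (auto simp: linorder_neq_iff)
  have ends: "b 0 = 0" "b (length \<sigma>) = length \<pi>" using \<sigma>(2) by (simp_all add: b_def)
  have b_less: "b i < b (Suc i)" if "i < length \<sigma>" for i
    using that \<sigma>(2) m_bound by (auto simp: b_def)
  have cross: "\<pi> ! p < \<pi> ! q \<longleftrightarrow> \<sigma> ! i < \<sigma> ! j"
    if ij: "i < length \<sigma>" "j < length \<sigma>" "i \<noteq> j"
      and p: "p \<in> {b i..<b (Suc i)}" and q: "q \<in> {b j..<b (Suc j)}" for i j p q
  proof -
    consider "i = 0" "j = 1" | "i = 1" "j = 0" using ij \<sigma>(2) by linarith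
    then show ?thesis
    proof cases
      case 1
      then show ?thesis using less[of p q] p q by (simp add: b_def)
    next
      case 2
      then show ?thesis using flip[of q p] p q by (simp add: b_def)
    qed
  qed
  obtain \<alpha>s where \<alpha>s: "is_decomposition \<pi> \<sigma> \<alpha>s" "\<And>i. i \<le> length \<sigma> \<Longrightarrow> seg_start \<alpha>s i = b i"
    using decomposition_from_cuts[OF \<pi> \<sigma>(1), of b] ends b_less cross by blast
  have "length (\<alpha>s ! 0) = m" using \<alpha>s(2)[of 1] \<sigma>(2) by (simp add: b_def seg_start_1)
  then show ?thesis using that \<alpha>s(1) by blast
qed

lemma indecomposable_by_iff:
  assumes \<pi>: "is_perm \<pi>" and \<sigma>: "is_perm \<sigma>" "length \<sigma> = 2"
  shows "indecomposable_by \<sigma> \<pi> \<longleftrightarrow> (\<forall>m. \<not> splits_at \<sigma> \<pi> m)"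
proof -
  have two: "length \<alpha>s = length \<sigma> \<longleftrightarrow> (\<exists>\<alpha> \<beta>. \<alpha>s = [\<alpha>, \<beta>])" for \<alpha>s :: "nat list list"
    using \<sigma>(2) by (auto simp: length_Suc_conv numeral_2_eq_2)
  have "(\<exists>\<alpha> \<beta>. is_perm \<alpha> \<and> is_perm \<beta> \<and> \<pi> = inflate \<sigma> [\<alpha>, \<beta>]) \<longleftrightarrow> (\<exists>\<alpha>s. is_decomposition \<pi> \<sigma> \<alpha>s)"
    unfolding is_decomposition_def two by force
  also have "\<dots> \<longleftrightarrow> (\<exists>m. splits_at \<sigma> \<pi> m)"
    using splits_at_decomposition[OF \<sigma>(1) _ \<sigma>(2)] decomposition_of_splits_at[OF \<pi> \<sigma>] by metis
  finally show ?thesis by (simp add: indecomposable_by_def)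
qed

text \<open>
  Beyond the first part, all comparisons required of a cut at \<open>l\<close> hold already because \<open>\<pi>\<close> splits at the
  end of that part.
\<close>

lemma splits_at_first_part:
  assumes \<sigma>: "is_perm \<sigma>" "is_decomposition \<pi> \<sigma> \<alpha>s" and k: "length \<sigma> = 2"
    and l: "l < length (\<alpha>s ! 0)"
  shows "splits_at \<sigma> (\<alpha>s ! 0) l \<longleftrightarrow> splits_at \<sigma> \<pi> l"
proof -
  let ?m = "length (\<alpha>s ! 0)"
  have m: "?m < length \<pi>"
    and less: "\<And>p q. p < ?m \<Longrightarrow> q \<in> {?m..<length \<pi>} \<Longrightarrow> \<pi> ! p < \<pi> ! q \<longleftrightarrow> \<sigma> ! 0 < \<sigma> ! 1"
    using splits_at_decomposition[OF \<sigma> k] by (auto simp: splits_at_def)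
  have same: "\<alpha>s ! 0 ! p < \<alpha>s ! 0 ! q \<longleftrightarrow> \<pi> ! p < \<pi> ! q" if "p < ?m" "q < ?m" for p q
    using decomposition_less_iff_same[OF \<sigma>, of 0 p q] k that by (simp add: seg_start_0)
  have "(\<forall>q\<in>{l..<?m}. \<pi> ! p < \<pi> ! q \<longleftrightarrow> \<sigma> ! 0 < \<sigma> ! 1) \<longleftrightarrow>
      (\<forall>q\<in>{l..<length \<pi>}. \<pi> ! p < \<pi> ! q \<longleftrightarrow> \<sigma> ! 0 < \<sigma> ! 1)" if "p < l" for p
    using less[of p] that l m by (auto simp: not_less)
  then show ?thesis using same l m by (auto simp: splits_at_def)
qed

text \<open>
  The first part is indecomposable if and only if it ends at the least position where \<open>\<pi>\<close> splits, since
  its own cuts are the earlier cuts of \<open>\<pi>\<close>.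
\<close>

lemma two_part_decomposition_unique:
  assumes \<pi>: "is_perm \<pi>" and \<sigma>: "is_perm \<sigma>" "length \<sigma> = 2"
    and ex: "\<exists>\<alpha>s. is_decomposition \<pi> \<sigma> \<alpha>s"
  shows "\<exists>!\<alpha>s. is_decomposition \<pi> \<sigma> \<alpha>s \<and> indecomposable_by \<sigma> (\<alpha>s ! 0)"
proof -
  define m where "m = (LEAST m. splits_at \<sigma> \<pi> m)"
  have "\<exists>m. splits_at \<sigma> \<pi> m" using ex splits_at_decomposition \<sigma> by blast
  then have m: "splits_at \<sigma> \<pi> m" and m_least: "\<And>l. l < m \<Longrightarrow> \<not> splits_at \<sigma> \<pi> l"
    unfolding m_def by (auto intro: LeastI_ex dest: not_less_Least)
  have first: "indecomposable_by \<sigma> (\<alpha>s ! 0) \<longleftrightarrow> length (\<alpha>s ! 0) = m"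
    if dec: "is_decomposition \<pi> \<sigma> \<alpha>s" for \<alpha>s
  proof -
    have "is_perm (\<alpha>s ! 0)" using decompositionD(4)[OF \<sigma>(1) dec] \<sigma>(2) by simp
    then have "indecomposable_by \<sigma> (\<alpha>s ! 0) \<longleftrightarrow> (\<forall>l. \<not> splits_at \<sigma> (\<alpha>s ! 0) l)"
      using indecomposable_by_iff \<sigma> by blast
    also have "\<dots> \<longleftrightarrow> (\<forall>l<length (\<alpha>s ! 0). \<not> splits_at \<sigma> \<pi> l)"
      using splits_at_first_part[OF \<sigma>(1) dec \<sigma>(2)] by (metis splits_at_def)
    also have "\<dots> \<longleftrightarrow> length (\<alpha>s ! 0) = m"
      using m m_least splits_at_decomposition[OF \<sigma>(1) dec \<sigma>(2)] by (metis linorder_neqE_nat)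
    finally show ?thesis .
  qed
  obtain \<alpha>s where \<alpha>s: "is_decomposition \<pi> \<sigma> \<alpha>s" "length (\<alpha>s ! 0) = m"
    using decomposition_of_splits_at[OF \<pi> \<sigma> m] by blast
  show ?thesis
  proof (rule ex1I[of _ \<alpha>s])
    show "is_decomposition \<pi> \<sigma> \<alpha>s \<and> indecomposable_by \<sigma> (\<alpha>s ! 0)" using \<alpha>s first by blast
    fix \<beta>s assume \<beta>s: "is_decomposition \<pi> \<sigma> \<beta>s \<and> indecomposable_by \<sigma> (\<beta>s ! 0)"
    then have len: "length (\<beta>s ! 0) = m" using first by blast
    have "seg_start \<alpha>s i = seg_start \<beta>s i" if "i \<le> length \<sigma>" for i
    proof -
      consider "i = 0" | "i = 1" | "i = length \<sigma>" using \<open>i \<le> length \<sigma>\<close> \<sigma>(2) by linarith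
      then show ?thesis
      proof cases
        case 3
        then show ?thesis
          using decompositionD(3)[OF \<sigma>(1) \<alpha>s(1)] decompositionD(3)[OF \<sigma>(1)] \<beta>s by metis
      qed (use \<alpha>s(2) len in \<open>simp_all add: seg_start_0 seg_start_1\<close>)
    qed
    then show "\<beta>s = \<alpha>s"
      using decomposition_determined_by_starts[OF \<sigma>(1) \<alpha>s(1) \<sigma>(1)] \<beta>s by auto
  qed
qed

lemma two_part_quotient_unique:
  assumes \<sigma>: "is_perm \<sigma>" "length \<sigma> = 2" "is_decomposition \<pi> \<sigma> \<alpha>s"
    and \<tau>: "is_perm \<tau>" "length \<tau> = 2" "is_decomposition \<pi> \<tau> \<beta>s"
  shows "\<sigma> = \<tau>"
proof -
  have ends: "\<pi> ! 0 < \<pi> ! (length \<pi> - 1) \<longleftrightarrow> \<rho> ! 0 < \<rho> ! 1"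
    if \<rho>: "is_perm \<rho>" "is_decomposition \<pi> \<rho> \<gamma>s" "length \<rho> = 2" for \<rho> \<gamma>s
  proof -
    obtain m where "splits_at \<rho> \<pi> m" using splits_at_decomposition[OF \<rho>] by blast
    then have "0 < m" "length \<pi> - 1 \<in> {m..<length \<pi>}"
      and "\<And>p q. p < m \<Longrightarrow> q \<in> {m..<length \<pi>} \<Longrightarrow> \<pi> ! p < \<pi> ! q \<longleftrightarrow> \<rho> ! 0 < \<rho> ! 1"
      by (auto simp: splits_at_def)
    then show ?thesis by blast
  qed
  have "\<sigma> ! 0 < \<sigma> ! 1 \<longleftrightarrow> \<tau> ! 0 < \<tau> ! 1" using ends \<sigma> \<tau> by blast
  then show ?thesis using is_perm_length_2[OF \<sigma>(1,2)] is_perm_length_2[OF \<tau>(1,2)] by auto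
qed

section \<open>The substitution decomposition\<close>

lemma simple_quotient_unique:
  assumes \<sigma>: "is_simple \<sigma>" "2 \<le> length \<sigma>" "is_decomposition \<pi> \<sigma> \<alpha>s"
    and \<tau>: "is_simple \<tau>" "2 \<le> length \<tau>" "is_decomposition \<pi> \<tau> \<beta>s"
  shows "\<sigma> = \<tau>"
proof -
  consider "2 < length \<sigma>" | "2 < length \<tau>" | "length \<sigma> = 2" "length \<tau> = 2"
    using \<sigma>(2) \<tau>(2) by linarith
  then show ?thesis
  proof cases
    case 3
    then show ?thesis using two_part_quotient_unique \<sigma> \<tau> by (auto simp: is_simple_def)
  qed (use simple_decomposition_unique \<sigma> \<tau> in metis)+
qed

theorem theorem1:
  fixes \<pi> :: "nat list"
  assumes "is_perm \<pi>" and "length \<pi> \<ge> 2"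
  shows "(\<exists>!\<sigma>. is_simple \<sigma> \<and> length \<sigma> \<ge> 2 \<and> (\<exists>\<alpha>s. is_decomposition \<pi> \<sigma> \<alpha>s)) \<and>
    (\<forall>\<sigma>. is_simple \<sigma> \<and> length \<sigma> \<ge> 2 \<and> (\<exists>\<alpha>s. is_decomposition \<pi> \<sigma> \<alpha>s) \<longrightarrow>
       (\<sigma> \<noteq> [1, 2] \<and> \<sigma> \<noteq> [2, 1] \<longrightarrow> (\<exists>!\<alpha>s. is_decomposition \<pi> \<sigma> \<alpha>s)) \<and>
       (\<sigma> = [1, 2] \<longrightarrow>
          (\<exists>!\<alpha>s. is_decomposition \<pi> \<sigma> \<alpha>s \<and> plus_indecomposable (\<alpha>s ! 0))) \<and>
       (\<sigma> = [2, 1] \<longrightarrow>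
          (\<exists>!\<alpha>s. is_decomposition \<pi> \<sigma> \<alpha>s \<and> minus_indecomposable (\<alpha>s ! 0))))"
proof (intro conjI allI impI)
  show "\<exists>!\<sigma>. is_simple \<sigma> \<and> length \<sigma> \<ge> 2 \<and> (\<exists>\<alpha>s. is_decomposition \<pi> \<sigma> \<alpha>s)"
    using simple_decomposition_exists[OF assms] simple_quotient_unique by metis
next
  fix \<sigma> assume \<sigma>: "is_simple \<sigma> \<and> length \<sigma> \<ge> 2 \<and> (\<exists>\<alpha>s. is_decomposition \<pi> \<sigma> \<alpha>s)"
    and "\<sigma> \<noteq> [1, 2] \<and> \<sigma> \<noteq> [2, 1]"
  then have "length \<sigma> \<noteq> 2" using is_perm_length_2 by (auto simp: is_simple_def)
  then have "2 < length \<sigma>" using \<sigma> by simp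
  then show "\<exists>!\<alpha>s. is_decomposition \<pi> \<sigma> \<alpha>s"
    using \<sigma> simple_decomposition_unique by metis
next
  fix \<sigma> assume \<sigma>: "is_simple \<sigma> \<and> length \<sigma> \<ge> 2 \<and> (\<exists>\<alpha>s. is_decomposition \<pi> \<sigma> \<alpha>s)" and "\<sigma> = [1, 2]"
  moreover from this have "indecomposable_by \<sigma> = plus_indecomposable"
    by (auto simp: fun_eq_iff indecomposable_by_def plus_indecomposable_def)
  ultimately show "\<exists>!\<alpha>s. is_decomposition \<pi> \<sigma> \<alpha>s \<and> plus_indecomposable (\<alpha>s ! 0)"
    using two_part_decomposition_unique[OF assms(1), of \<sigma>] by (simp add: is_simple_def)
next
  fix \<sigma> assume \<sigma>: "is_simple \<sigma> \<and> length \<sigma> \<ge> 2 \<and> (\<exists>\<alpha>s. is_decomposition \<pi> \<sigma> \<alpha>s)" and "\<sigma> = [2, 1]"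
  moreover from this have "indecomposable_by \<sigma> = minus_indecomposable"
    by (auto simp: fun_eq_iff indecomposable_by_def minus_indecomposable_def)
  ultimately show "\<exists>!\<alpha>s. is_decomposition \<pi> \<sigma> \<alpha>s \<and> minus_indecomposable (\<alpha>s ! 0)"
    using two_part_decomposition_unique[OF assms(1), of \<sigma>] by (simp add: is_simple_def)
qed

end
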